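(* Let $D=V_1V_2\cdots V_{2n}$ be an even-sided discrete conic, lying on a conic $C$, with foci $F,F'$. The intersections of opposite sides of $D$ (the points $V_iV_{i+1}\cap V_{i+n}V_{i+n+1}$) lie on a line orthogonal to $FF'$ and form another discrete conic. In the special case when $C$ is a parabola, this line is the directrix of the parabola.
   Context: Let $C$ be a conic with focus $F$. A discrete conic (on $C$) is a polygon $V_1V_2\cdots V_m$ with vertices on $C$ such that, for some fixed $\theta\in\mathbb{R}$, $\angle V_iFV_{i+1}=\theta$ for every $i\in\{1,2,\ldots,m\}$. When $C$ is a hyperbola, a parabola or a degenerate conic, the rays used in measuring an angle are allowed to wrap around the plane. The sides $V_iV_{i+1}$ of a discrete conic are tangent to a conic with focus $F$, denoted $C_L$. Let $F'$ be the other focus of $C_L$; $F$ and $F'$ are called the foci of the discrete conic. *)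

theory Defs
  imports "HOL-Analysis.Analysis"
begin

text \<open>
  The Euclidean plane is \<^typ>\<open>complex\<close>, and the real projective plane extending it is described by
  homogeneous coordinates: a nonzero \<open>(w, z)\<close> stands for the point \<open>w / z\<close> if \<open>z \<noteq> 0\<close> and for
  the point at infinity in direction \<open>w\<close> if \<open>z = 0\<close>. Two nonzero vectors name the same point iff
  one lies in the span of the other. Lines are two-dimensional subspaces and conics are cones, so
  both contain the vector \<open>0\<close>, which is not a point.
\<close>

type_synonym hpoint = "complex \<times> real"

definition is_line :: "hpoint set \<Rightarrow> bool" where
  "is_line l \<longleftrightarrow> subspace l \<and> dim l = 2"

definition line_at_infinity :: "hpoint set" where
  "line_at_infinity = {x. snd x = 0}"

definition orthogonal_lines :: "hpoint set \<Rightarrow> hpoint set \<Rightarrow> bool" where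
  "orthogonal_lines l m \<longleftrightarrow>
     is_line l \<and> is_line m \<and> l \<noteq> line_at_infinity \<and> m \<noteq> line_at_infinity \<and>
     (\<forall>x \<in> l \<inter> line_at_infinity. \<forall>y \<in> m \<inter> line_at_infinity. fst x \<bullet> fst y = 0)"

text \<open>
  The focus-directrix equation. For \<open>d = (a, c)\<close> with \<open>a \<noteq> 0\<close> the affine points \<open>P\<close> of
  \<open>focal_conic F d\<close> satisfy \<open>|P - F| = |a \<bullet> P + c|\<close>, that is, \<open>|P - F| = e * dist P l\<close> with
  eccentricity \<open>e = norm a\<close> and directrix \<open>l\<close> given by \<open>a \<bullet> P + c = 0\<close>. For \<open>a = 0\<close> it is the
  circle with centre \<open>F\<close> and radius \<open>|c|\<close>, whose directrix is the line at infinity. The conic is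
  nondegenerate iff \<open>F\<close> does not lie on the directrix.
\<close>

definition focal_conic :: "complex \<Rightarrow> hpoint \<Rightarrow> hpoint set" where
  "focal_conic F d = {x. norm (fst x - snd x *\<^sub>R F) = \<bar>d \<bullet> x\<bar>}"

definition conic_with_focus :: "hpoint set \<Rightarrow> complex \<Rightarrow> bool" where
  "conic_with_focus K F \<longleftrightarrow> (\<exists>d. d \<bullet> (F, 1) \<noteq> 0 \<and> K = focal_conic F d)"

definition circle_with_centre :: "hpoint set \<Rightarrow> complex \<Rightarrow> bool" where
  "circle_with_centre K F \<longleftrightarrow> (\<exists>r>0. K = focal_conic F (0, r))"

definition parabola_with :: "hpoint set \<Rightarrow> complex \<Rightarrow> hpoint set \<Rightarrow> bool" where
  "parabola_with K F l \<longleftrightarrow>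
     (\<exists>d. norm (fst d) = 1 \<and> d \<bullet> (F, 1) \<noteq> 0 \<and> K = focal_conic F d \<and> l = {x. d \<bullet> x = 0})"

text \<open>
  The limit of \<open>|P - F| = e * dist P l\<close> for \<open>e\<close> tending to infinity is the (double) line \<open>l\<close>.
\<close>

definition degenerate_conic_with_focus :: "hpoint set \<Rightarrow> complex \<Rightarrow> bool" where
  "degenerate_conic_with_focus K F \<longleftrightarrow> is_line K \<and> (F, 1) \<notin> K"

text \<open>
  The second focus of a circle is its centre again, and that of a parabola is the point at infinity
  of its axis, which is the only point at infinity of the parabola.
\<close>

definition other_focus :: "hpoint set \<Rightarrow> complex \<Rightarrow> hpoint \<Rightarrow> bool" where
  "other_focus K F X \<longleftrightarrow> conic_with_focus K F \<and> X \<noteq> 0 \<and>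
     ((\<exists>G. X \<in> span {(G, 1)} \<and> conic_with_focus K G \<and> (G = F \<longrightarrow> circle_with_centre K F)) \<or>
      ((\<exists>l. parabola_with K F l) \<and> X \<in> K \<inter> line_at_infinity))"

definition tangent_line :: "hpoint set \<Rightarrow> hpoint set \<Rightarrow> bool" where
  "tangent_line l K \<longleftrightarrow> is_line l \<and> (\<exists>x. x \<noteq> 0 \<and> l \<inter> K = span {x})"

text \<open>
  The ray from \<open>F\<close> in the unit direction \<open>u\<close>, wrapping around the plane: \<open>wrapped_ray F u t\<close> is the
  point \<open>F + tan t *\<^sub>R u\<close>. For \<open>0 < t < pi / 2\<close> this is the usual ray, at \<open>t = pi / 2\<close> it passes
  through infinity, and for \<open>pi / 2 < t < pi\<close> it comes back to \<open>F\<close> from the opposite side.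
\<close>

definition wrapped_ray :: "complex \<Rightarrow> complex \<Rightarrow> real \<Rightarrow> hpoint" where
  "wrapped_ray F u t = (cos t *\<^sub>R F + sin t *\<^sub>R u, cos t)"

text \<open>
  \<open>X\<close> is the first point of \<open>C\<close> on the wrapped ray. For an ellipse this point is always reached
  before the ray wraps. For a hyperbola, the points of the branch not around \<open>F\<close> are reached only
  after wrapping; in terms of the polar equation they are the points with negative radius.
  For a line not through \<open>F\<close>, each point is reached by two opposite rays.
\<close>

definition ray_reaches :: "hpoint set \<Rightarrow> complex \<Rightarrow> complex \<Rightarrow> hpoint \<Rightarrow> bool" where
  "ray_reaches C F u X \<longleftrightarrow>
     (\<exists>t. 0 < t \<and> t < pi \<and> wrapped_ray F u t \<in> C \<and>
          (\<forall>s. 0 < s \<and> s < t \<longrightarrow> wrapped_ray F u s \<notin> C) \<and>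
          X \<in> span {wrapped_ray F u t})"

definition has_angle :: "hpoint set \<Rightarrow> complex \<Rightarrow> hpoint \<Rightarrow> hpoint \<Rightarrow> real \<Rightarrow> bool" where
  "has_angle C F X Y \<theta> \<longleftrightarrow>
     (\<exists>u. norm u = 1 \<and> ray_reaches C F u X \<and> ray_reaches C F (cis \<theta> * u) Y)"

text \<open>
  The vertices of an \<open>m\<close>-gon are \<open>V 0, \<dots>, V (m - 1)\<close>, with indices read modulo \<open>m\<close>.
\<close>

definition side :: "nat \<Rightarrow> (nat \<Rightarrow> hpoint) \<Rightarrow> nat \<Rightarrow> hpoint set" where
  "side m V i = span {V (i mod m), V (Suc i mod m)}"

text \<open>Digons are admitted: a quadrilateral has only two pairs of opposite sides.\<close>

definition polygon :: "nat \<Rightarrow> (nat \<Rightarrow> hpoint) \<Rightarrow> bool" where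
  "polygon m V \<longleftrightarrow> 2 \<le> m \<and> (\<forall>i<m. V i \<noteq> 0) \<and>
     (\<forall>i<m. \<forall>j<m. i \<noteq> j \<longrightarrow> V i \<notin> span {V j})"

definition discrete_conic :: "nat \<Rightarrow> (nat \<Rightarrow> hpoint) \<Rightarrow> hpoint set \<Rightarrow> complex \<Rightarrow> bool" where
  "discrete_conic m V C F \<longleftrightarrow>
     (conic_with_focus C F \<or> degenerate_conic_with_focus C F) \<and>
     polygon m V \<and> (\<forall>i<m. V i \<in> C) \<and>
     (\<exists>\<theta>. \<forall>i<m. has_angle C F (V i) (V (Suc i mod m)) \<theta>)"

definition discrete_conic_foci :: "nat \<Rightarrow> (nat \<Rightarrow> hpoint) \<Rightarrow> complex \<Rightarrow> hpoint \<Rightarrow> bool" where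
  "discrete_conic_foci m V F F' \<longleftrightarrow>
     (\<exists>CL. conic_with_focus CL F \<and> (\<forall>i<m. tangent_line (side m V i) CL) \<and> other_focus CL F F')"

end

theory Submission
  imports Defs
begin

text \<open>
  In coordinates \<open>w = from_focus F x\<close>, \<open>z = snd x\<close> centred at the focus, the conic \<open>|w| = |d \<bullet> x|\<close> is
  parametrised by the directions \<open>u\<close> of the rays from \<open>F\<close>, with \<open>u \<mapsto> (p u, 1 - a \<bullet> u)\<close>, where
  \<open>a = fst d\<close> and \<open>p = d \<bullet> (F, 1)\<close>. The directions of a discrete \<open>2n\<close>-gon are \<open>\<zeta>\<^sup>i u\<close> for a
  primitive \<open>2n\<close>-th root of unity \<open>\<zeta> = cis \<theta>\<close>, so opposite vertices have opposite directions. The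
  side whose angle at \<open>F\<close> is bisected by the direction \<open>m\<close> is \<open>m \<bullet> w = cos (\<theta> / 2) * (d \<bullet> x)\<close>, and its
  opposite side is obtained by replacing \<open>m\<close> with \<open>- m\<close>. They meet where \<open>d \<bullet> x = 0\<close> and
  \<open>m \<bullet> w = 0\<close>: on the directrix of \<open>C\<close>, in the direction orthogonal to \<open>m\<close>. The same equation shows
  that the sides are tangent to the conic with form \<open>cos (\<theta> / 2) *\<^sub>R d\<close>, and they determine it up to
  sign, so the foci lie on a line with direction \<open>a\<close>.
\<close>

section \<open>Coordinates centred at the focus and the polar parametrisation\<close>

definition from_focus :: "complex \<Rightarrow> hpoint \<Rightarrow> complex" where
  "from_focus F x = fst x - snd x *\<^sub>R F"

text \<open>The polar equation r = p / (1 - a . u), with a = \<open>fst d\<close> and p =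
  \<open>d \<bullet> (F, 1)\<close>, cleared of its denominator: points at infinity and points of
  negative radius then need no separate treatment.\<close>

definition conic_point :: "complex \<Rightarrow> hpoint \<Rightarrow> complex \<Rightarrow> hpoint" where
  "conic_point F d u = ((d \<bullet> (F, 1)) *\<^sub>R u + (1 - fst d \<bullet> u) *\<^sub>R F, 1 - fst d \<bullet> u)"

text \<open>The polar equation r = - p / (a . u) of the directrix in the same homogeneous form.
  Directions \<open>u\<close> and \<open>- u\<close> name the same point here, unlike on the
  conic.\<close>

definition directrix_point :: "complex \<Rightarrow> hpoint \<Rightarrow> complex \<Rightarrow> hpoint" where
  "directrix_point F d u = ((d \<bullet> (F, 1)) *\<^sub>R u - (fst d \<bullet> u) *\<^sub>R F, - (fst d \<bullet> u))"

lemma hpoint_inner_split: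
  "d \<bullet> x = fst d \<bullet> from_focus F x + snd x * (d \<bullet> (F, 1))"
  by (simp add: inner_prod_def from_focus_def algebra_simps)

lemma hpoint_eqI:
  assumes "from_focus F x = from_focus F y" "snd x = snd y"
  shows "x = y"
  using assms by (auto simp: from_focus_def prod_eq_iff)

lemma from_focus_simps [simp]:
  "from_focus F (x + y) = from_focus F x + from_focus F y"
  "from_focus F (r *\<^sub>R x) = r *\<^sub>R from_focus F x"
  "from_focus F (F, 1) = 0"
  by (auto simp: from_focus_def algebra_simps)

lemma from_focus_conic_point [simp]: "from_focus F (conic_point F d u) = (d \<bullet> (F, 1)) *\<^sub>R u"
  and snd_conic_point [simp]: "snd (conic_point F d u) = 1 - fst d \<bullet> u"
  by (auto simp: from_focus_def conic_point_def)

lemma from_focus_directrix_point [simp]: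
    "from_focus F (directrix_point F d u) = (d \<bullet> (F, 1)) *\<^sub>R u"
  and snd_directrix_point [simp]: "snd (directrix_point F d u) = - (fst d \<bullet> u)"
  by (auto simp: from_focus_def directrix_point_def)

lemma from_focus_wrapped_ray [simp]: "from_focus F (wrapped_ray F u t) = sin t *\<^sub>R u"
  and snd_wrapped_ray [simp]: "snd (wrapped_ray F u t) = cos t"
  by (auto simp: from_focus_def wrapped_ray_def)

lemma inner_conic_point [simp]: "d \<bullet> conic_point F d u = d \<bullet> (F, 1)"
  unfolding hpoint_inner_split[of d "conic_point F d u" F] by (simp add: algebra_simps)

lemma inner_directrix_point [simp]: "d \<bullet> directrix_point F d u = 0"
  unfolding hpoint_inner_split[of d "directrix_point F d u" F] by (simp add: algebra_simps)

lemma inner_wrapped_ray: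
  "d \<bullet> wrapped_ray F u t = sin t * (fst d \<bullet> u) + cos t * (d \<bullet> (F, 1))"
  unfolding hpoint_inner_split[of d "wrapped_ray F u t" F] by simp

lemma mem_focal_conic: "x \<in> focal_conic F d \<longleftrightarrow> norm (from_focus F x) = \<bar>d \<bullet> x\<bar>"
  by (simp add: focal_conic_def from_focus_def)

lemma conic_point_nonzero:
  assumes "d \<bullet> (F, 1) \<noteq> 0" "norm u = 1"
  shows "conic_point F d u \<noteq> 0"
proof
  assume "conic_point F d u = 0"
  then have "d \<bullet> conic_point F d u = 0" by (metis inner_zero_right)
  with assms show False by simp
qed

lemma conic_point_on_conic:
  assumes "norm u = 1"
  shows "conic_point F d u \<in> focal_conic F d"
  using assms by (simp add: mem_focal_conic)

text \<open>The form \<open>d\<close> has the same nonzero value at all conic points, so its value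
  at \<open>x\<close> fixes the scalar of this representative. The direction is thereby recovered
  with its sign.\<close>

lemma conic_point_unique:
  assumes p: "d \<bullet> (F, 1) \<noteq> 0" and u: "norm u = 1" and v: "norm v = 1"
    and x: "x \<noteq> 0" "x \<in> span {conic_point F d u}" "x \<in> span {conic_point F d v}"
  shows "u = v"
proof -
  obtain r where r: "x = r *\<^sub>R conic_point F d u" using x by (auto simp: span_singleton)
  obtain s where s: "x = s *\<^sub>R conic_point F d v" using x by (auto simp: span_singleton)
  have "d \<bullet> x = r * (d \<bullet> (F, 1))" "d \<bullet> x = s * (d \<bullet> (F, 1))"
    by (simp add: r, simp add: s)
  then have rs: "r = s" using p by simp
  have "from_focus F x = (r * (d \<bullet> (F, 1))) *\<^sub>R u" by (simp add: r)
  moreover have "from_focus F x = (r * (d \<bullet> (F, 1))) *\<^sub>R v" by (simp add: s rs)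
  moreover have "r \<noteq> 0" using x r by auto
  ultimately show ?thesis using p by simp
qed

lemma focal_conic_conic_point:
  assumes p: "d \<bullet> (F, 1) \<noteq> 0" and x: "x \<noteq> 0" "x \<in> focal_conic F d"
  obtains u r where "norm u = 1" "r \<noteq> 0" "x = r *\<^sub>R conic_point F d u"
proof -
  define p where "p = d \<bullet> (F, 1)"
  define k where "k = d \<bullet> x"
  have k: "norm (from_focus F x) = \<bar>k\<bar>" using x by (simp add: mem_focal_conic k_def)
  have ks: "k = fst d \<bullet> from_focus F x + snd x * p"
    unfolding k_def p_def by (rule hpoint_inner_split)
  have k0: "k \<noteq> 0"
  proof
    assume "k = 0"
    with k ks p have "from_focus F x = 0" "snd x = 0" by (auto simp: p_def)
    then have "x = 0" by (simp add: from_focus_def prod_eq_iff)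
    with x show False by simp
  qed
  \<comment> \<open>The quotient by the signed \<open>k\<close>, not by its modulus, is independent
    of the representative of the point and gives the direction required by the polar equation on
    either branch of a hyperbola.\<close>
  define u where "u = (1 / k) *\<^sub>R from_focus F x"
  have "norm u = 1" using k k0 by (simp add: u_def)
  moreover have "x = (k / p) *\<^sub>R conic_point F d u"
  proof (rule hpoint_eqI[of F])
    show "from_focus F x = from_focus F ((k / p) *\<^sub>R conic_point F d u)"
      using k0 p by (simp add: u_def p_def)
    have "k * (1 - fst d \<bullet> u) = snd x * p"
      using k0 ks by (simp add: u_def right_diff_distrib)
    then show "snd x = snd ((k / p) *\<^sub>R conic_point F d u)"
      using p by (simp add: p_def[symmetric] field_simps)
  qed
  moreover have "k / p \<noteq> 0" using k0 p by (simp add: p_def)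
  ultimately show thesis using that by blast
qed

section \<open>First hits of wrapped rays on conics and lines\<close>

text \<open>The wrapped ray has affine radius tan t, so solving for its intersections prescribes cot
  t, which is finite on all of (0, pi), also where the ray passes through infinity.\<close>

lemma angle_with_cotangent:
  fixes x :: real
  obtains t where "0 < t" "t < pi" "cos t = x * sin t"
proof
  show "0 < pi / 2 - arctan x" "pi / 2 - arctan x < pi"
    using arctan_bounded[of x] by auto
  show "cos (pi / 2 - arctan x) = x * sin (pi / 2 - arctan x)"
    using cos_arctan_not_zero[of x] tan_arctan[of x]
    unfolding cos_diff sin_diff by (simp add: tan_def field_simps)
qed

text \<open>Both sides are decided by the sign of
  \<open>sin (t - s) = sin s * sin t * (x - y)\<close>. Orderings of hits along a ray thus become
  orderings of cotangents.\<close>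

lemma cotangent_antimono:
  assumes "0 < s" "s < pi" "0 < t" "t < pi" "cos s = x * sin s" "cos t = y * sin t"
  shows "s < t \<longleftrightarrow> y < x"
proof -
  have pos: "sin s > 0" "sin t > 0" using assms by (auto intro: sin_gt_zero)
  have e: "sin (t - s) = (sin s * sin t) * (x - y)"
    using assms by (simp add: sin_diff algebra_simps)
  show ?thesis
  proof
    assume "s < t"
    then have "sin (t - s) > 0" using assms by (intro sin_gt_zero) auto
    moreover have "sin s * sin t > 0" using pos by simp
    ultimately have "0 < x - y" unfolding e by (rule zero_less_mult_pos)
    then show "y < x" by simp
  next
    assume "y < x"
    then have "sin (t - s) > 0" using e pos by simp
    show "s < t"
    proof (rule ccontr)
      assume "\<not> s < t"
      then have "sin (s - t) \<ge> 0" using assms by (intro sin_ge_zero) auto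
      moreover have "sin (s - t) = - sin (t - s)" by (simp add: sin_diff)
      ultimately show False using \<open>sin (t - s) > 0\<close> by simp
    qed
  qed
qed

text \<open>
  The wrapped ray meets the conic at the parameters with cotangent \<open>(\<plusminus> 1 - a \<bullet> u) / p\<close>, where
  \<open>a = fst d\<close> and \<open>p = d \<bullet> (F, 1)\<close>; for positive \<open>p\<close> the plus sign comes first.
\<close>

lemma ray_reaches_conic_point:
  assumes p: "d \<bullet> (F, 1) > 0" and u: "norm u = 1"
    and X: "ray_reaches (focal_conic F d) F u X"
  shows "X \<in> span {conic_point F d u}"
proof -
  define p where "p = d \<bullet> (F, 1)"
  have p0: "p > 0" using p by (simp add: p_def)
  obtain t where t: "0 < t" "t < pi" "wrapped_ray F u t \<in> focal_conic F d"
    and first: "\<And>s. 0 < s \<Longrightarrow> s < t \<Longrightarrow> wrapped_ray F u s \<notin> focal_conic F d"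
    and Xt: "X \<in> span {wrapped_ray F u t}"
    using X unfolding ray_reaches_def by blast
  have st: "sin t > 0" using t by (intro sin_gt_zero)
  have on: "sin t = \<bar>sin t * (fst d \<bullet> u) + cos t * p\<bar>"
    using t(3) u st by (simp add: mem_focal_conic inner_wrapped_ray p_def)
  obtain s where s: "0 < s" "s < pi" "cos s = (1 - fst d \<bullet> u) / p * sin s"
    using angle_with_cotangent by blast
  have ss: "sin s > 0" using s by (intro sin_gt_zero)
  have "cos s * p = sin s * (1 - fst d \<bullet> u)" using s(3) p0 by (simp add: field_simps)
  then have "wrapped_ray F u s \<in> focal_conic F d"
    using u ss by (simp add: mem_focal_conic inner_wrapped_ray p_def[symmetric] algebra_simps)
  then have "\<not> s < t" using first s by blast
  have ct: "cos t * p = sin t * (1 - fst d \<bullet> u)"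
  proof (rule ccontr)
    assume "cos t * p \<noteq> sin t * (1 - fst d \<bullet> u)"
    then have "sin t * (fst d \<bullet> u) + cos t * p = - sin t"
      using on by (auto simp: abs_if algebra_simps split: if_splits)
    then have "cos t = (- 1 - fst d \<bullet> u) / p * sin t"
      using p0 by (simp add: field_simps)
    moreover have "(- 1 - fst d \<bullet> u) / p < (1 - fst d \<bullet> u) / p"
      using p0 by (simp add: divide_strict_right_mono)
    ultimately have "s < t" using cotangent_antimono s t by blast
    with \<open>\<not> s < t\<close> show False by simp
  qed
  have "wrapped_ray F u t = (sin t / p) *\<^sub>R conic_point F d u"
  proof (rule hpoint_eqI[of F])
    show "from_focus F (wrapped_ray F u t) = from_focus F ((sin t / p) *\<^sub>R conic_point F d u)"
      using p0 by (simp add: p_def[symmetric])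
    show "snd (wrapped_ray F u t) = snd ((sin t / p) *\<^sub>R conic_point F d u)"
      using ct p0 by (simp add: field_simps)
  qed
  with Xt show ?thesis by (auto simp: span_singleton)
qed

text \<open>The equation of a line off \<open>F\<close> prescribes the cotangent of the parameter,
  so each wrapped ray meets the line exactly once and the first hit is the only one.\<close>

lemma ray_reaches_directrix_point:
  assumes p: "d \<bullet> (F, 1) > 0" and X: "X \<in> span {directrix_point F d u}"
  shows "ray_reaches {x. d \<bullet> x = 0} F u X"
proof -
  define p where "p = d \<bullet> (F, 1)"
  have p0: "p > 0" using p by (simp add: p_def)
  obtain t where t: "0 < t" "t < pi" "cos t = - (fst d \<bullet> u) / p * sin t"
    using angle_with_cotangent by blast
  have st: "sin t > 0" using t by (intro sin_gt_zero)
  have eq: "directrix_point F d u = (p / sin t) *\<^sub>R wrapped_ray F u t"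
  proof (rule hpoint_eqI[of F])
    show "from_focus F (directrix_point F d u) = from_focus F ((p / sin t) *\<^sub>R wrapped_ray F u t)"
      using st by (simp add: p_def[symmetric])
    show "snd (directrix_point F d u) = snd ((p / sin t) *\<^sub>R wrapped_ray F u t)"
      using t p0 st by (simp add: field_simps)
  qed
  have "wrapped_ray F u t \<in> {x. d \<bullet> x = 0}"
    using t p0 by (simp add: inner_wrapped_ray p_def[symmetric])
  moreover have "wrapped_ray F u s \<notin> {x. d \<bullet> x = 0}" if s: "0 < s" "s < t" for s
  proof
    assume "wrapped_ray F u s \<in> {x. d \<bullet> x = 0}"
    then have "cos s = - (fst d \<bullet> u) / p * sin s"
      using p0 by (simp add: inner_wrapped_ray p_def[symmetric] field_simps)
    then have "s < t \<longleftrightarrow> - (fst d \<bullet> u) / p < - (fst d \<bullet> u) / p"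
      using s t by (intro cotangent_antimono) auto
    then show False using s by simp
  qed
  moreover have "X \<in> span {wrapped_ray F u t}"
    using X eq by (auto simp: span_singleton)
  ultimately show ?thesis unfolding ray_reaches_def using t by blast
qed

section \<open>Lines as kernels of linear forms, and tangency\<close>

lemma dim_span_pair:
  fixes x y :: "'a::euclidean_space"
  assumes "y \<noteq> 0" "x \<notin> span {y}"
  shows "dim (span {x, y}) = 2"
proof -
  have "independent {x, y}" using assms by (simp add: independent_insert)
  moreover have "x \<noteq> y" using assms by (auto simp: span_base)
  ultimately show ?thesis by (simp add: dim_eq_card_independent)
qed

lemma is_line_hyperplane:
  fixes e :: hpoint
  assumes "e \<noteq> 0"
  shows "is_line {x. e \<bullet> x = 0}"
  using assms by (simp add: is_line_def subspace_hyperplane dim_hyperplane)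

lemma span_pair_eq_hyperplane:
  fixes e x y :: hpoint
  assumes "e \<noteq> 0" "e \<bullet> x = 0" "e \<bullet> y = 0" "y \<noteq> 0" "x \<notin> span {y}"
  shows "span {x, y} = {z. e \<bullet> z = 0}"
proof (rule subspace_dim_equal)
  show "span {x, y} \<subseteq> {z. e \<bullet> z = 0}"
    using assms by (intro span_minimal) (auto simp: subspace_hyperplane)
  show "dim {z. e \<bullet> z = 0} \<le> dim (span {x, y})"
    using assms by (simp add: dim_span_pair dim_hyperplane del: dim_span)
qed (auto simp: subspace_hyperplane)

text \<open>
  Reflecting a solution \<open>u\<close> of \<open>\<beta> \<bullet> u = - \<gamma>\<close> in the direction \<open>\<beta>\<close> gives a second solution, and
  hence a second intersection of the line with the conic, unless \<open>u\<close> is parallel to \<open>\<beta>\<close>.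
\<close>

lemma tangent_line_norm_eq:
  assumes p: "d \<bullet> (F, 1) \<noteq> 0"
    and tangent: "tangent_line {x. e \<bullet> x = 0} (focal_conic F d)"
  shows "norm ((d \<bullet> (F, 1)) *\<^sub>R fst e - (e \<bullet> (F, 1)) *\<^sub>R fst d) = \<bar>e \<bullet> (F, 1)\<bar>"
proof -
  define \<gamma> where "\<gamma> = e \<bullet> (F, 1)"
  define \<beta> where "\<beta> = (d \<bullet> (F, 1)) *\<^sub>R fst e - \<gamma> *\<^sub>R fst d"
  have e: "e \<bullet> conic_point F d u = \<beta> \<bullet> u + \<gamma>" for u
    unfolding hpoint_inner_split[of e "conic_point F d u" F] by (simp add: \<beta>_def \<gamma>_def algebra_simps)
  obtain x where x: "x \<noteq> 0" "{x. e \<bullet> x = 0} \<inter> focal_conic F d = span {x}"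
    using tangent unfolding tangent_line_def by blast
  then have "x \<in> focal_conic F d" "e \<bullet> x = 0" using span_base[of x "{x}"] by auto
  then obtain u r where u: "norm u = 1" "r \<noteq> 0" "x = r *\<^sub>R conic_point F d u"
    using focal_conic_conic_point p x(1) by metis
  with \<open>e \<bullet> x = 0\<close> e have bu: "\<beta> \<bullet> u = - \<gamma>" by simp
  have "norm \<beta> = \<bar>\<gamma>\<bar>"
  proof (cases "\<beta> = 0")
    case True
    with bu show ?thesis by simp
  next
    case False
    define v where "v = (2 * (\<beta> \<bullet> u) / (\<beta> \<bullet> \<beta>)) *\<^sub>R \<beta> - u"
    have b0: "\<beta> \<bullet> \<beta> \<noteq> 0" using False by simp
    have uu: "u \<bullet> u = 1" using u by (simp add: norm_eq_1)
    have "v \<bullet> v = 1"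
      using b0 uu by (simp add: v_def inner_diff inner_commute field_simps power2_eq_square)
    then have v: "norm v = 1" by (simp add: norm_eq_1)
    have "\<beta> \<bullet> v = - \<gamma>" using b0 bu by (simp add: v_def inner_diff)
    then have "conic_point F d v \<in> span {x}"
      using e[of v] conic_point_on_conic[OF v, of F d] x(2) by (metis IntI add.left_inverse mem_Collect_eq)
    then have "conic_point F d v \<in> span {conic_point F d u}"
      using u by (auto simp: span_singleton)
    then have "v = u"
      using conic_point_unique[OF p v u(1), of "conic_point F d v"] conic_point_nonzero[OF p v]
        span_base[of _ "{conic_point F d v}"] by auto
    \<comment> \<open>Being fixed by the reflection, \<open>u\<close> equals its projection onto
      \<beta>; comparing norms gives equality in Cauchy-Schwarz.\<close>
    then have "2 *\<^sub>R u = (2 * (\<beta> \<bullet> u) / (\<beta> \<bullet> \<beta>)) *\<^sub>R \<beta>" by (simp add: v_def algebra_simps scaleR_2)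
    then have "norm (2 *\<^sub>R u) = norm ((2 * (\<beta> \<bullet> u) / (\<beta> \<bullet> \<beta>)) *\<^sub>R \<beta>)" by (rule arg_cong)
    then have "norm \<beta> = \<bar>\<beta> \<bullet> u\<bar>"
      using u False by (simp add: abs_mult dot_square_norm power2_eq_square field_simps)
    then show ?thesis by (simp add: bu)
  qed
  then show ?thesis by (simp add: \<beta>_def \<gamma>_def)
qed

section \<open>How far a focal conic determines its form and its foci\<close>

lemma proportional_formI:
  fixes d e :: hpoint
  assumes p: "d \<bullet> (F, 1) \<noteq> 0" and f: "(d \<bullet> (F, 1)) *\<^sub>R fst e = (e \<bullet> (F, 1)) *\<^sub>R fst d"
  shows "e = ((e \<bullet> (F, 1)) / (d \<bullet> (F, 1))) *\<^sub>R d"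
proof -
  define p where "p = d \<bullet> (F, 1)"
  define q where "q = e \<bullet> (F, 1)"
  have p0: "p \<noteq> 0" using p by (simp add: p_def)
  have "(1 / p) *\<^sub>R (p *\<^sub>R fst e) = (1 / p) *\<^sub>R (q *\<^sub>R fst d)"
    using f by (simp add: p_def q_def)
  then have f': "fst e = (q / p) *\<^sub>R fst d" using p0 by simp
  have "snd e = q - fst e \<bullet> F" "snd d = p - fst d \<bullet> F"
    by (auto simp: q_def p_def inner_prod_def)
  then have "snd e = (q / p) * snd d" using f' p0 by (simp add: right_diff_distrib)
  with f' show ?thesis by (simp add: prod_eq_iff p_def q_def)
qed

text \<open>On the parametrised conic the form \<open>e\<close> becomes an affine function of
  \<open>u\<close> with constant modulus on the unit circle. Its values at the two unit vectors
  along its gradient \<open>h\<close> force \<open>h = 0\<close>, because its constant term is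
  nonzero.\<close>

lemma focal_conic_inject:
  assumes p: "d \<bullet> (F, 1) \<noteq> 0" "e \<bullet> (F, 1) \<noteq> 0" and eq: "focal_conic F d = focal_conic F e"
  obtains k where "k \<noteq> 0" "e = k *\<^sub>R d"
proof -
  define p where "p = d \<bullet> (F, 1)"
  define q where "q = e \<bullet> (F, 1)"
  define h where "h = p *\<^sub>R fst e - q *\<^sub>R fst d"
  have on: "\<bar>h \<bullet> u + q\<bar> = \<bar>p\<bar>" if "norm u = 1" for u
  proof -
    have "conic_point F d u \<in> focal_conic F e" using conic_point_on_conic[OF that] eq by metis
    moreover have "e \<bullet> conic_point F d u = h \<bullet> u + q"
      unfolding hpoint_inner_split[of e "conic_point F d u" F] by (simp add: p_def q_def h_def algebra_simps)
    ultimately show ?thesis using that by (simp add: mem_focal_conic p_def)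
  qed
  have "h = 0"
  proof (rule ccontr)
    assume h: "h \<noteq> 0"
    define u where "u = (1 / norm h) *\<^sub>R h"
    have u: "norm u = 1" using h by (simp add: u_def)
    then have "(h \<bullet> u + q)\<^sup>2 = p\<^sup>2" "(h \<bullet> (- u) + q)\<^sup>2 = p\<^sup>2"
      using on[of u] on[of "- u"] by (auto simp: power2_eq_iff abs_eq_iff)
    then have "4 * (q * (h \<bullet> u)) = 0" unfolding inner_minus_right by algebra
    then have "h \<bullet> u = 0" using p by (simp add: q_def)
    then show False using h by (simp add: u_def)
  qed
  have "e = (q / p) *\<^sub>R d"
    unfolding p_def q_def
    by (rule proportional_formI[OF p(1)]) (use \<open>h = 0\<close> in \<open>simp add: h_def p_def q_def\<close>)
  moreover have "q / p \<noteq> 0" using p by (simp add: p_def q_def)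
  ultimately show thesis using that by blast
qed

lemma complex_orthonormal_expansion:
  fixes u x y :: complex
  assumes "norm u = 1"
  shows "x = (x \<bullet> u) *\<^sub>R u + (x \<bullet> (\<i> * u)) *\<^sub>R (\<i> * u)"
    and "x \<bullet> y = (x \<bullet> u) * (y \<bullet> u) + (x \<bullet> (\<i> * u)) * (y \<bullet> (\<i> * u))"
proof -
  have u: "(Re u)\<^sup>2 + (Im u)\<^sup>2 = 1" using assms by (metis cmod_power2 one_power2)
  show x: "x = (x \<bullet> u) *\<^sub>R u + (x \<bullet> (\<i> * u)) *\<^sub>R (\<i> * u)"
  proof (rule complex_eqI)
    show "Re x = Re ((x \<bullet> u) *\<^sub>R u + (x \<bullet> (\<i> * u)) *\<^sub>R (\<i> * u))"
      using u unfolding inner_complex_def by simp algebra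
    show "Im x = Im ((x \<bullet> u) *\<^sub>R u + (x \<bullet> (\<i> * u)) *\<^sub>R (\<i> * u))"
      using u unfolding inner_complex_def by simp algebra
  qed
  show "x \<bullet> y = (x \<bullet> u) * (y \<bullet> u) + (x \<bullet> (\<i> * u)) * (y \<bullet> (\<i> * u))"
    by (subst x) (simp add: inner_add_left inner_commute[of y])
qed

text \<open>
  Substituting the parametrisation of the conic into the second focal equation gives an identity
  in the direction \<open>u\<close>, whose odd and even parts are separated by \<open>u \<mapsto> - u\<close>. The basis below is
  chosen so that the linear form \<open>h\<close> on the right-hand side vanishes on its first vector.
\<close>

lemma foci_on_axis:
  assumes p: "d \<bullet> (F, 1) \<noteq> 0" and eq: "focal_conic F d = focal_conic G e" and "G \<noteq> F"
  obtains k where "G - F = k *\<^sub>R fst d"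
proof -
  define p where "p = d \<bullet> (F, 1)"
  define q where "q = e \<bullet> (F, 1)"
  define a where "a = fst d"
  define g where "g = G - F"
  define h where "h = p *\<^sub>R fst e - q *\<^sub>R a"
  have p0: "p \<noteq> 0" using p by (simp add: p_def)
  have on: "p\<^sup>2 - 2 * p * (1 - a \<bullet> u) * (g \<bullet> u) + (1 - a \<bullet> u)\<^sup>2 * (g \<bullet> g) = (h \<bullet> u + q)\<^sup>2"
    if u: "norm u = 1" for u
  proof -
    have "conic_point F d u \<in> focal_conic G e" using conic_point_on_conic[OF u] eq by metis
    moreover have "e \<bullet> conic_point F d u = h \<bullet> u + q"
      unfolding hpoint_inner_split[of e "conic_point F d u" F]
      by (simp add: p_def q_def h_def a_def algebra_simps)
    moreover have "from_focus G (conic_point F d u) = p *\<^sub>R u - (1 - a \<bullet> u) *\<^sub>R g"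
      by (simp add: from_focus_def conic_point_def p_def a_def g_def algebra_simps)
    ultimately have "norm (p *\<^sub>R u - (1 - a \<bullet> u) *\<^sub>R g) = \<bar>h \<bullet> u + q\<bar>"
      by (simp add: mem_focal_conic)
    then have "(norm (p *\<^sub>R u - (1 - a \<bullet> u) *\<^sub>R g))\<^sup>2 = (h \<bullet> u + q)\<^sup>2" by simp
    moreover have "u \<bullet> u = 1" using u by (simp add: norm_eq_1)
    ultimately show ?thesis
      unfolding power2_norm_eq_inner inner_diff_left inner_diff_right
      by (simp add: inner_commute power2_eq_square algebra_simps)
  qed
  have odd: "- (p * (g \<bullet> u)) - (g \<bullet> g) * (a \<bullet> u) = q * (h \<bullet> u)" if u: "norm u = 1" for u
    using on[of u] on[of "- u"] u unfolding inner_minus_right norm_minus_cancel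
    by (simp add: power2_eq_square algebra_simps)
  have even: "p\<^sup>2 + 2 * p * (a \<bullet> u) * (g \<bullet> u) + (g \<bullet> g) * (1 + (a \<bullet> u)\<^sup>2) = q\<^sup>2 + (h \<bullet> u)\<^sup>2"
    if u: "norm u = 1" for u
    using on[of u] on[of "- u"] u unfolding inner_minus_right norm_minus_cancel
    by (simp add: power2_eq_square algebra_simps)
  obtain u where u: "norm u = 1" and hu: "h \<bullet> u = 0"
  proof (cases "h = 0")
    case True
    then show ?thesis using that[of 1] by simp
  next
    case False
    have "norm ((1 / norm h) *\<^sub>R (\<i> * h)) = 1" using False by (simp add: norm_mult)
    moreover have "h \<bullet> ((1 / norm h) *\<^sub>R (\<i> * h)) = 0" by (simp add: inner_complex_def)
    ultimately show ?thesis using that by blast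
  qed
  define v where "v = \<i> * u"
  have v: "norm v = 1" using u by (simp add: v_def norm_mult)
  have uv: "u \<bullet> v = 0" "v \<bullet> u = 0" by (auto simp: v_def inner_complex_def)
  have uu: "u \<bullet> u = 1" "v \<bullet> v = 1" using u v by (auto simp: norm_eq_1)
  have gg: "g \<bullet> g = (g \<bullet> u)\<^sup>2 + (g \<bullet> v)\<^sup>2"
    using complex_orthonormal_expansion(2)[OF u, of g g] by (simp add: v_def power2_eq_square)
  \<comment> \<open>Two rational unit vectors, mirror images in the line along \<open>u\<close>:
    subtracting the even identities at them leaves only the coefficient of the mixed
    product.\<close>
  have w: "norm ((3/5) *\<^sub>R u + (4/5) *\<^sub>R v) = 1" "norm ((3/5) *\<^sub>R u - (4/5) *\<^sub>R v) = 1"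
    unfolding norm_eq_1 by (simp_all add: inner_add inner_diff uv uu)
  have mixed: "p * ((a \<bullet> u) * (g \<bullet> v) + (a \<bullet> v) * (g \<bullet> u)) + (g \<bullet> g) * (a \<bullet> u) * (a \<bullet> v) = 0"
    using even[OF w(1)] even[OF w(2)] hu
    unfolding inner_add_right inner_diff_right inner_scaleR_right by (simp add: power2_eq_square algebra_simps)
  have ou: "p * (g \<bullet> u) = - ((g \<bullet> g) * (a \<bullet> u))" using odd[OF u] hu by simp
  have "p * ((a \<bullet> u) * (g \<bullet> v)) = 0" using mixed ou by algebra
  then have au_gv: "a \<bullet> u = 0 \<or> g \<bullet> v = 0" using p0 by simp
  have g0: "g \<noteq> 0" using \<open>G \<noteq> F\<close> by (simp add: g_def)
  \<comment> \<open>Otherwise \<open>g\<close> is parallel to \<open>u\<close>. The identities at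
    \<open>u\<close> then give p = - (g . u)(a . u) and q^2 = (g . u)^2, and with these the
    identities at \<open>v\<close> give p^2 = 0.\<close>
  have au: "a \<bullet> u = 0"
  proof (rule ccontr)
    assume au: "a \<bullet> u \<noteq> 0"
    then have gv: "g \<bullet> v = 0" using au_gv by simp
    then have gu: "g \<bullet> u \<noteq> 0" using g0 gg by (metis add_0_right inner_eq_zero_iff power_zero_numeral)
    have gg': "g \<bullet> g = (g \<bullet> u)\<^sup>2" using gg gv by simp
    have "(g \<bullet> u) * (p + (g \<bullet> u) * (a \<bullet> u)) = 0"
      using ou unfolding gg' by (simp add: power2_eq_square algebra_simps)
    then have pe: "p = - ((g \<bullet> u) * (a \<bullet> u))" using gu by (simp add: eq_neg_iff_add_eq_0)
    have qq: "q\<^sup>2 = (g \<bullet> u)\<^sup>2"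
      using even[OF u] unfolding hu gg' pe by (simp add: power2_eq_square algebra_simps)
    have "(g \<bullet> u)\<^sup>2 * (a \<bullet> v) = - (q * (h \<bullet> v))" using odd[OF v] gv unfolding gg' by simp
    then have "((g \<bullet> u)\<^sup>2 * (a \<bullet> v))\<^sup>2 = q\<^sup>2 * (h \<bullet> v)\<^sup>2" by (simp add: power_mult_distrib)
    then have "(g \<bullet> u)\<^sup>2 * ((g \<bullet> u)\<^sup>2 * (a \<bullet> v)\<^sup>2 - (h \<bullet> v)\<^sup>2) = 0"
      unfolding qq by (simp add: power2_eq_square algebra_simps)
    then have "(g \<bullet> u)\<^sup>2 * (a \<bullet> v)\<^sup>2 = (h \<bullet> v)\<^sup>2" using gu by simp
    then have "p\<^sup>2 = 0" using even[OF v] gv unfolding gg' qq by (simp add: algebra_simps)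
    with p0 show False by simp
  qed
  then have gu: "g \<bullet> u = 0" using ou p0 by simp
  have g: "g = (g \<bullet> v) *\<^sub>R v" and a: "a = (a \<bullet> v) *\<^sub>R v"
    using complex_orthonormal_expansion(1)[OF u, of g] complex_orthonormal_expansion(1)[OF u, of a]
    by (simp_all add: gu au v_def)
  have gv: "g \<bullet> v \<noteq> 0" using g g0 by auto
  \<comment> \<open>If \<open>a\<close> vanished, the conic would be a circle: the even identities
    give \<open>h \<bullet> v = 0\<close>, and the odd one then contradicts
    \<open>g \<bullet> v \<noteq> 0\<close>. So a circle has no second focus.\<close>
  have "a \<bullet> v \<noteq> 0"
  proof
    assume av: "a \<bullet> v = 0"
    have "h \<bullet> v = 0" using even[OF u] even[OF v] by (simp add: au hu av)
    then show False using odd[OF v] gv p0 by (simp add: av)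
  qed
  then have "g = ((g \<bullet> v) / (a \<bullet> v)) *\<^sub>R a" using g by (subst a) simp
  then show thesis using that by (simp add: g_def a_def)
qed

section \<open>The directions of a discrete conic\<close>

text \<open>Each side supplies its own pair of rays. A vertex determines its direction, so the rays
  of consecutive sides fit together into one orbit of the rotation by \<theta>. Closing up makes
  \<open>cis \<theta>\<close> an \<open>m\<close>-th root of unity, and distinctness of the vertices
  makes it primitive.\<close>

lemma discrete_conic_directions:
  assumes p: "d \<bullet> (F, 1) > 0" and D: "discrete_conic m V (focal_conic F d) F"
  obtains \<theta> u where "norm u = 1" "cis \<theta> ^ m = 1" "\<And>j. 0 < j \<Longrightarrow> j < m \<Longrightarrow> cis \<theta> ^ j \<noteq> 1"
    "\<And>i. V (i mod m) \<in> span {conic_point F d (cis \<theta> ^ i * u)}"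
proof -
  have p0: "d \<bullet> (F, 1) \<noteq> 0" using p by simp
  have m: "2 \<le> m" and V0: "\<And>i. i < m \<Longrightarrow> V i \<noteq> 0"
    and V: "\<And>i j. i < m \<Longrightarrow> j < m \<Longrightarrow> i \<noteq> j \<Longrightarrow> V i \<notin> span {V j}"
    using D unfolding discrete_conic_def polygon_def by auto
  obtain \<theta> where "\<forall>i<m. has_angle (focal_conic F d) F (V i) (V (Suc i mod m)) \<theta>"
    using D unfolding discrete_conic_def by blast
  then obtain w where w: "\<And>i. i < m \<Longrightarrow> norm (w i) = 1"
    and r1: "\<And>i. i < m \<Longrightarrow> ray_reaches (focal_conic F d) F (w i) (V i)"
    and r2: "\<And>i. i < m \<Longrightarrow> ray_reaches (focal_conic F d) F (cis \<theta> * w i) (V (Suc i mod m))"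
    unfolding has_angle_def by metis
  have w': "norm (cis \<theta> * w i) = 1" if "i < m" for i using w that by (simp add: norm_mult)
  have s1: "V i \<in> span {conic_point F d (w i)}" if "i < m" for i
    using ray_reaches_conic_point[OF p w r1] that by blast
  have s2: "V (Suc i mod m) \<in> span {conic_point F d (cis \<theta> * w i)}" if "i < m" for i
    using ray_reaches_conic_point[OF p w' r2] that by blast
  have step: "w (Suc i mod m) = cis \<theta> * w i" if "i < m" for i
  proof -
    have "Suc i mod m < m" using m by simp
    then show ?thesis using conic_point_unique[OF p0 w w' V0 s1 s2] that by blast
  qed
  have wi: "w (i mod m) = cis \<theta> ^ i * w 0" for i
  proof (induction i)
    case (Suc i)
    have "w (Suc i mod m) = w (Suc (i mod m) mod m)" by (simp add: mod_Suc_eq)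
    also have "\<dots> = cis \<theta> * w (i mod m)" using m by (intro step) simp
    finally show ?case by (simp add: Suc)
  qed simp
  have w0: "w 0 \<noteq> 0" using w[of 0] m by auto
  have "w 0 = cis \<theta> ^ m * w 0" using wi[of m] by simp
  then have "cis \<theta> ^ m = 1" using w0 by simp
  moreover have "cis \<theta> ^ j \<noteq> 1" if j: "0 < j" "j < m" for j
  proof
    assume "cis \<theta> ^ j = 1"
    then have "w j = w 0" using wi[of j] j by simp
    then have "V j \<in> span {conic_point F d (w 0)}" "V 0 \<in> span {conic_point F d (w 0)}"
      using s1[of j] s1[of 0] j by auto
    then obtain r s where rs: "V j = r *\<^sub>R conic_point F d (w 0)" "V 0 = s *\<^sub>R conic_point F d (w 0)"
      by (auto simp: span_singleton)
    moreover have "s \<noteq> 0" using rs V0[of 0] j by auto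
    ultimately have "V j = (r / s) *\<^sub>R V 0" by simp
    then have "V j \<in> span {V 0}" by (auto simp: span_singleton)
    then show False using V[of j 0] j by auto
  qed
  moreover have "V (i mod m) \<in> span {conic_point F d (cis \<theta> ^ i * w 0)}" for i
    using s1[of "i mod m"] m by (simp add: wi)
  moreover have "norm (w 0) = 1" using w m by simp
  ultimately show thesis using that by blast
qed

section \<open>Equations of the sides\<close>

definition chord_form :: "complex \<Rightarrow> hpoint \<Rightarrow> real \<Rightarrow> complex \<Rightarrow> hpoint" where
  "chord_form F d c m = c *\<^sub>R d - (m, - (m \<bullet> F))"

lemma inner_chord_form [simp]:
  "chord_form F d c m \<bullet> x = c * (d \<bullet> x) - m \<bullet> from_focus F x"
  by (simp add: chord_form_def inner_prod_def from_focus_def algebra_simps)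

lemma fst_chord_form [simp]: "fst (chord_form F d c m) = c *\<^sub>R fst d - m"
  by (simp add: chord_form_def)

lemma inner_half_rotation:
  fixes u :: complex
  assumes "norm u = 1"
  shows "(cis (\<theta> / 2) * u) \<bullet> u = cos (\<theta> / 2)"
    and "(cis (\<theta> / 2) * u) \<bullet> (cis \<theta> * u) = cos (\<theta> / 2)"
proof -
  have rot: "(x * u) \<bullet> (y * u) = x \<bullet> y" for x y
  proof -
    have "(Re u)\<^sup>2 + (Im u)\<^sup>2 = 1" using assms by (metis cmod_power2 one_power2)
    then show ?thesis unfolding inner_complex_def by simp algebra
  qed
  show "(cis (\<theta> / 2) * u) \<bullet> u = cos (\<theta> / 2)"
    using rot[of "cis (\<theta> / 2)" 1] by (simp add: inner_complex_def)
  have "cos (\<theta> / 2) = cos (\<theta> - \<theta> / 2)" by simp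
  then show "(cis (\<theta> / 2) * u) \<bullet> (cis \<theta> * u) = cos (\<theta> / 2)"
    unfolding rot cos_diff by (simp add: inner_complex_def mult.commute)
qed

text \<open>At the conic point of direction u the form equals p (cos (\<theta> / 2) - m . u), which
  vanishes at both ends since the bisector m makes the angle \<theta> / 2 with each. The form is
  nonzero because its value at \<open>(F, 1)\<close> is p cos (\<theta> / 2).\<close>

lemma chord_eq_hyperplane:
  assumes p: "d \<bullet> (F, 1) \<noteq> 0" and u: "norm u = 1" and c: "cos (\<theta> / 2) \<noteq> 0"
    and x: "x \<in> span {conic_point F d u}" and y: "y \<in> span {conic_point F d (cis \<theta> * u)}"
    and xy: "y \<noteq> 0" "x \<notin> span {y}"
  shows "span {x, y} = {z. chord_form F d (cos (\<theta> / 2)) (cis (\<theta> / 2) * u) \<bullet> z = 0}"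
proof (rule span_pair_eq_hyperplane)
  have "chord_form F d (cos (\<theta> / 2)) (cis (\<theta> / 2) * u) \<bullet> (F, 1) \<noteq> 0" using p c by simp
  then show "chord_form F d (cos (\<theta> / 2)) (cis (\<theta> / 2) * u) \<noteq> 0" by (metis inner_zero_left)
  show "chord_form F d (cos (\<theta> / 2)) (cis (\<theta> / 2) * u) \<bullet> x = 0"
    "chord_form F d (cos (\<theta> / 2)) (cis (\<theta> / 2) * u) \<bullet> y = 0"
    using x y inner_half_rotation[OF u, of \<theta>] by (auto simp: span_singleton)
qed (use xy in auto)

section \<open>The directrix, the axis and the conic tangent to the sides\<close>

lemma orthogonal_lines_directrix:
  assumes p: "d \<bullet> (F, 1) \<noteq> 0" and X: "X \<notin> span {(F, 1)}" "from_focus F X = k *\<^sub>R fst d"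
  shows "orthogonal_lines {x. d \<bullet> x = 0} (span {(F, 1), X})"
proof -
  \<comment> \<open>Since \<open>X\<close> is not the focus, \<open>fst d\<close> is nonzero, which
    keeps the directrix away from infinity.\<close>
  have ka: "k *\<^sub>R fst d \<noteq> 0"
  proof
    assume "k *\<^sub>R fst d = 0"
    then have "X = snd X *\<^sub>R (F, 1)" using X(2) by (intro hpoint_eqI[of F]) (auto simp: from_focus_def)
    then show False using X(1) by (metis insertI1 span_base span_scale)
  qed
  have "is_line {x. d \<bullet> x = 0}" using p by (intro is_line_hyperplane) auto
  moreover have "is_line (span {(F, 1), X})"
    using dim_span_pair[OF _ X(1)] by (simp add: is_line_def insert_commute zero_prod_def)
  moreover have "{x. d \<bullet> x = 0} \<noteq> line_at_infinity"
  proof -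
    have "(fst d, 0) \<in> line_at_infinity" by (simp add: line_at_infinity_def)
    moreover have "d \<bullet> (fst d, 0) \<noteq> 0" using ka by (simp add: inner_prod_def)
    ultimately show ?thesis by blast
  qed
  moreover have "span {(F, 1), X} \<noteq> line_at_infinity"
    using span_base[of "(F, 1)" "{(F, 1), X}"] by (auto simp: line_at_infinity_def)
  moreover have "fst x \<bullet> fst y = 0"
    if x: "x \<in> {x. d \<bullet> x = 0} \<inter> line_at_infinity" and y: "y \<in> span {(F, 1), X} \<inter> line_at_infinity"
    for x y
  proof -
    obtain r s where rs: "y - r *\<^sub>R (F, 1) = s *\<^sub>R X"
      using y by (auto simp: span_insert span_singleton)
    have "fst y = from_focus F y" using y by (simp add: from_focus_def line_at_infinity_def)
    moreover have "y = r *\<^sub>R (F, 1) + s *\<^sub>R X" using rs by (simp add: algebra_simps)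
    ultimately have "fst y = (s * k) *\<^sub>R fst d" using X(2) by (simp del: scaleR_Pair)
    moreover have "fst x \<bullet> fst d = 0"
      using x by (auto simp: line_at_infinity_def inner_prod_def inner_commute)
    ultimately show ?thesis by simp
  qed
  ultimately show ?thesis unfolding orthogonal_lines_def by blast
qed

lemma other_focus_on_axis:
  assumes p: "d \<bullet> (F, 1) \<noteq> 0" and X: "other_focus (focal_conic F d) F X" "X \<notin> span {(F, 1)}"
  obtains k where "from_focus F X = k *\<^sub>R fst d"
proof -
  consider (finite) G where "X \<in> span {(G, 1)}" "conic_with_focus (focal_conic F d) G"
    | (infinite) l where "parabola_with (focal_conic F d) F l" "X \<in> focal_conic F d \<inter> line_at_infinity"
    using X unfolding other_focus_def by blast
  then show thesis
  proof cases
    case finite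
    then obtain e r where e: "focal_conic F d = focal_conic G e" and r: "X = r *\<^sub>R (G, 1)"
      unfolding conic_with_focus_def by (auto simp: span_singleton)
    have "G \<noteq> F" using X(2) finite by auto
    then obtain k where "G - F = k *\<^sub>R fst d" using foci_on_axis[OF p e] by blast
    moreover have "from_focus F X = r *\<^sub>R (G - F)" by (simp add: r from_focus_def algebra_simps)
    ultimately show thesis using that[of "r * k"] by simp
  next
    case infinite
    then obtain e where e: "norm (fst e) = 1" "e \<bullet> (F, 1) \<noteq> 0" "focal_conic F d = focal_conic F e"
      unfolding parabola_with_def by blast
    obtain j where j: "e = j *\<^sub>R d" using focal_conic_inject[OF p e(2,3)] by blast
    have X0: "snd X = 0" using infinite by (simp add: line_at_infinity_def)
    have "X \<in> focal_conic F e" using infinite e by simp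
    then have "norm (fst X) = \<bar>fst e \<bullet> fst X\<bar>"
      using X0 by (simp add: mem_focal_conic from_focus_def inner_prod_def)
    \<comment> \<open>For eccentricity 1 a point at infinity of the conic attains equality in
      Cauchy-Schwarz, so it is the direction of the axis.\<close>
    then have "\<bar>fst e \<bullet> fst X\<bar> = norm (fst e) * norm (fst X)" using e by simp
    then have "norm (fst e) *\<^sub>R fst X = norm (fst X) *\<^sub>R fst e \<or>
        norm (fst e) *\<^sub>R fst X = - norm (fst X) *\<^sub>R fst e"
      by (simp add: norm_cauchy_schwarz_abs_eq)
    then obtain s where "fst X = s *\<^sub>R fst e" unfolding e(1) scaleR_one by blast
    then have "from_focus F X = (s * j) *\<^sub>R fst d" using X0 by (simp add: from_focus_def j)
    then show thesis using that by blast
  qed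
qed

text \<open>
  The conditions \<open>|y \<mp> r *\<^sub>R m| = s\<close> coming from a pair of opposite sides force \<open>y\<close> to be orthogonal
  to \<open>m\<close>; two pairs force \<open>y = 0\<close>.
\<close>

lemma opposite_tangents_same_directrix:
  assumes p: "d \<bullet> (F, 1) \<noteq> 0" and q: "e \<bullet> (F, 1) \<noteq> 0"
    and m: "norm m = 1" and sin: "sin \<theta> \<noteq> 0"
    and tangent: "\<And>w. w \<in> {m, - m, cis \<theta> * m, - (cis \<theta> * m)} \<Longrightarrow>
      tangent_line {x. chord_form F d c w \<bullet> x = 0} (focal_conic F e)"
  obtains k where "k \<noteq> 0" "e = k *\<^sub>R d"
proof -
  define p where "p = d \<bullet> (F, 1)"
  define q where "q = e \<bullet> (F, 1)"
  \<comment> \<open>The part of the tangency condition of \<open>tangent_line_norm_eq\<close> that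
    does not depend on the bisector \<open>w\<close>.\<close>
  define y where "y = c *\<^sub>R (q *\<^sub>R fst d - p *\<^sub>R fst e)"
  have n: "norm (y - q *\<^sub>R w) = \<bar>c * p\<bar>" if "w \<in> {m, - m, cis \<theta> * m, - (cis \<theta> * m)}" for w
    using tangent_line_norm_eq[OF q tangent[OF that]]
    by (simp add: y_def p_def q_def algebra_simps)
  have perp: "y \<bullet> w = 0" if "norm (y - q *\<^sub>R w) = \<bar>c * p\<bar>" "norm (y - q *\<^sub>R (- w)) = \<bar>c * p\<bar>" for w
  proof -
    have "(y - q *\<^sub>R w) \<bullet> (y - q *\<^sub>R w) = (y - q *\<^sub>R (- w)) \<bullet> (y - q *\<^sub>R (- w))"
      using that by (metis dot_square_norm)
    then have "q * (y \<bullet> w) = 0"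
      by (simp add: inner_diff_left inner_diff_right inner_add_left inner_add_right inner_commute)
    then show ?thesis using q by (simp add: q_def)
  qed
  have y0: "y \<bullet> m = 0" by (intro perp n) auto
  have "y \<bullet> (cis \<theta> * m) = 0" by (intro perp n) auto
  moreover have "cis \<theta> * m = cos \<theta> *\<^sub>R m + sin \<theta> *\<^sub>R (\<i> * m)"
    by (simp add: complex_eq_iff)
  ultimately have "y \<bullet> (\<i> * m) = 0" using y0 sin by (simp add: inner_add_right)
  then have "y = 0" using complex_orthonormal_expansion(1)[OF m, of y] y0 by simp
  then have "\<bar>q\<bar> = \<bar>c * p\<bar>" using n[of m] m by simp
  then have c: "c \<noteq> 0" using q by (auto simp: q_def)
  have "e = (q / p) *\<^sub>R d"
    unfolding p_def q_def
    by (rule proportional_formI[OF p]) (use \<open>y = 0\<close> c in \<open>simp add: y_def p_def q_def\<close>)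
  moreover have "q / p \<noteq> 0" using p q by (simp add: p_def q_def)
  ultimately show thesis using that by blast
qed

section \<open>Intersections of opposite sides\<close>

lemma directrix_point_in_spanD:
  assumes p: "d \<bullet> (F, 1) \<noteq> 0" and u: "norm u = 1" "norm v = 1"
    and "directrix_point F d u \<in> span {directrix_point F d v}"
  shows "u = v \<or> u = - v"
proof -
  obtain k where "directrix_point F d u = k *\<^sub>R directrix_point F d v"
    using assms by (auto simp: span_singleton)
  then have "from_focus F (directrix_point F d u) = from_focus F (k *\<^sub>R directrix_point F d v)"
    by simp
  then have "(d \<bullet> (F, 1)) *\<^sub>R u = (d \<bullet> (F, 1)) *\<^sub>R (k *\<^sub>R v)" by (simp add: mult.commute)
  then have uv: "u = k *\<^sub>R v" using p by (metis scaleR_left_imp_eq)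
  then have "\<bar>k\<bar> = 1" using u by simp
  then show ?thesis using uv by (auto simp: abs_if split: if_splits)
qed

text \<open>Adding and subtracting the two equations separates them into d . x = 0 and orthogonality
  to \<open>m\<close>; the directrix point of the direction orthogonal to \<open>m\<close> is the
  only solution.\<close>

lemma opposite_chords_Int:
  assumes p: "d \<bullet> (F, 1) \<noteq> 0" and m: "norm m = 1" and c: "c \<noteq> 0"
  shows "{x. chord_form F d c m \<bullet> x = 0} \<inter> {x. chord_form F d c (- m) \<bullet> x = 0} =
    span {directrix_point F d (\<i> * m)}" (is "?L = ?R")
proof
  have mm: "m \<bullet> (\<i> * m) = 0" by (simp add: inner_complex_def)
  show "?R \<subseteq> ?L"
    by (rule span_minimal) (auto simp: mm subspace_hyperplane subspace_inter simp del: inner_chord_form,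
        auto simp: mm)
  show "?L \<subseteq> ?R"
  proof
    fix x assume "x \<in> ?L"
    then have "c * (d \<bullet> x) = 0" and mx: "from_focus F x \<bullet> m = 0"
      by (auto simp: inner_commute[of "from_focus F x"])
    then have "d \<bullet> x = 0" using c by simp
    define k where "k = from_focus F x \<bullet> (\<i> * m)"
    have fx: "from_focus F x = k *\<^sub>R (\<i> * m)"
      using complex_orthonormal_expansion(1)[OF m, of "from_focus F x"] mx by (simp add: k_def)
    have "x = (k / (d \<bullet> (F, 1))) *\<^sub>R directrix_point F d (\<i> * m)"
    proof (rule hpoint_eqI[of F])
      show "from_focus F x = from_focus F ((k / (d \<bullet> (F, 1))) *\<^sub>R directrix_point F d (\<i> * m))"
        using p fx by simp
      have "k * (fst d \<bullet> (\<i> * m)) + snd x * (d \<bullet> (F, 1)) = 0"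
        using \<open>d \<bullet> x = 0\<close> hpoint_inner_split[of d x F] by (simp add: fx)
      then show "snd x = snd ((k / (d \<bullet> (F, 1))) *\<^sub>R directrix_point F d (\<i> * m))"
        using p by (simp add: field_simps add_eq_0_iff)
    qed
    then show "x \<in> ?R" by (auto simp: span_singleton)
  qed
qed

section \<open>Opposite sides of an even-sided discrete conic\<close>

theorem theorem7:
  fixes n :: nat and V :: "nat \<Rightarrow> hpoint" and C :: "hpoint set"
    and F :: complex and F' :: hpoint
  assumes "2 \<le> n"
    and "conic_with_focus C F"
    and "discrete_conic (2 * n) V C F"
    and "discrete_conic_foci (2 * n) V F F'"
  shows "\<exists>P l. is_line l \<and>
           (\<forall>i<n. P i \<noteq> 0 \<and> side (2 * n) V i \<inter> side (2 * n) V (i + n) = span {P i} \<and> P i \<in> l) \<and>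
           (F' \<notin> span {(F, 1)} \<longrightarrow> orthogonal_lines l (span {(F, 1), F'})) \<and>
           discrete_conic n P l F \<and>
           (\<forall>m. parabola_with C F m \<longrightarrow> l = m)"
proof -
  \<comment> \<open>The forms \<open>d\<close> and \<open>- d\<close> define the same conic. The
    positive sign is the one for which the ray in direction \<open>u\<close> first hits
    \<open>conic_point F d u\<close>.\<close>
  obtain d where C: "C = focal_conic F d" and p: "d \<bullet> (F, 1) > 0"
  proof -
    obtain d where d: "d \<bullet> (F, 1) \<noteq> 0" "C = focal_conic F d"
      using assms(2) unfolding conic_with_focus_def by blast
    have "focal_conic F (- d) = focal_conic F d" by (simp add: focal_conic_def)
    then show thesis using that[of d] that[of "- d"] d by fastforce
  qed
  have p0: "d \<bullet> (F, 1) \<noteq> 0" using p by simp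
  obtain \<theta> u where u: "norm u = 1" and z1: "cis \<theta> ^ (2 * n) = 1"
    and prim: "\<And>j. 0 < j \<Longrightarrow> j < 2 * n \<Longrightarrow> cis \<theta> ^ j \<noteq> 1"
    and VW: "\<And>i. V (i mod (2 * n)) \<in> span {conic_point F d (cis \<theta> ^ i * u)}"
    by (rule discrete_conic_directions[OF p assms(3)[unfolded C]]) (rule that)
  define c where "c = cos (\<theta> / 2)"
  define m where "m i = cis (\<theta> / 2) * (cis \<theta> ^ i * u)" for i
  have m: "norm (m i) = 1" for i using u by (simp add: m_def norm_mult norm_power)
  have mSuc: "m (Suc i) = cis \<theta> * m i" for i by (simp add: m_def)
  \<comment> \<open>The \<open>n\<close>-th power is a square root of 1 other than 1, so opposite
    sides have opposite bisectors.\<close>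
  have zn: "cis \<theta> ^ n = - 1"
  proof -
    have "(cis \<theta> ^ n)\<^sup>2 = 1" using z1 by (simp add: power_mult[symmetric] mult.commute)
    then show ?thesis using prim[of n] assms(1) by (auto simp: power2_eq_1_iff)
  qed
  have mn: "m (i + n) = - m i" for i by (simp add: m_def power_add zn)
  have inj: "i = j" if "cis \<theta> ^ i = cis \<theta> ^ j" "i < 2 * n" "j < 2 * n" for i j
    using that
  proof (induction i j rule: linorder_wlog)
    case (le i j)
    then have "cis \<theta> ^ i * cis \<theta> ^ (j - i) = cis \<theta> ^ i"
      by (metis le_add_diff_inverse power_add)
    then have "cis \<theta> ^ (j - i) = 1" by simp
    then show ?case using prim[of "j - i"] le by force
  qed simp
  \<comment> \<open>Here \<open>2 \<le> n\<close> enters: the order of \<open>cis \<theta>\<close>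
    exceeds 2, so consecutive bisectors are linearly independent and, by the double angle formula,
    \<open>c\<close> is nonzero.\<close>
  have z2: "cis \<theta> ^ 2 \<noteq> 1" using prim[of 2] assms(1) by simp
  have sin: "sin \<theta> \<noteq> 0"
  proof
    assume "sin \<theta> = 0"
    then have "cos \<theta> = 1 \<or> cos \<theta> = - 1" using sin_cos_squared_add[of \<theta>] by (simp add: power2_eq_1_iff)
    then have "cis \<theta> ^ 2 = 1" using \<open>sin \<theta> = 0\<close>
      by (auto simp: cis.ctr complex_eq_iff power2_eq_square)
    then show False using z2 by simp
  qed
  have c: "c \<noteq> 0"
    using sin sin_double[of "\<theta> / 2"] by (auto simp: c_def)
  have side: "side (2 * n) V i = {x. chord_form F d c (m i) \<bullet> x = 0}" for i
    unfolding side_def c_def m_def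
  proof (rule chord_eq_hyperplane[OF p0])
    show "norm (cis \<theta> ^ i * u) = 1" using u by (simp add: norm_mult norm_power)
    show "cos (\<theta> / 2) \<noteq> 0" using c by (simp add: c_def)
    show "V (i mod (2 * n)) \<in> span {conic_point F d (cis \<theta> ^ i * u)}" by (rule VW)
    show "V (Suc i mod (2 * n)) \<in> span {conic_point F d (cis \<theta> * (cis \<theta> ^ i * u))}"
      using VW[of "Suc i"] by (simp add: mult.assoc)
    have lt: "i mod (2 * n) < 2 * n" "Suc i mod (2 * n) < 2 * n" using assms(1) by auto
    moreover have "i mod (2 * n) \<noteq> Suc i mod (2 * n)" using assms(1) by (simp add: mod_Suc)
    ultimately show "V (Suc i mod (2 * n)) \<noteq> 0" "V (i mod (2 * n)) \<notin> span {V (Suc i mod (2 * n))}"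
      using assms(3) unfolding discrete_conic_def polygon_def by auto
  qed
  define l where "l = {x. d \<bullet> x = 0}"
  define P where "P i = directrix_point F d (\<i> * m i)" for i
  have im: "norm (\<i> * m i) = 1" for i using m by (simp add: norm_mult)
  have l: "is_line l" unfolding l_def using p0 by (intro is_line_hyperplane) auto
  have Pl: "P i \<in> l" for i by (simp add: P_def l_def)
  have P0: "P i \<noteq> 0" for i
  proof
    assume "P i = 0"
    then have "from_focus F (P i) = 0" by (simp add: from_focus_def)
    then show False using p0 m[of i] by (auto simp: P_def)
  qed
  have Int: "side (2 * n) V i \<inter> side (2 * n) V (i + n) = span {P i}" for i
    unfolding side mn P_def by (rule opposite_chords_Int[OF p0 m c])
  have orth: "orthogonal_lines l (span {(F, 1), F'})" if F': "F' \<notin> span {(F, 1)}"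
  proof -
    obtain CL where CL: "conic_with_focus CL F" "other_focus CL F F'"
      and tangent: "\<And>i. i < 2 * n \<Longrightarrow> tangent_line (side (2 * n) V i) CL"
      using assms(4) unfolding discrete_conic_foci_def by blast
    obtain e where e: "e \<bullet> (F, 1) \<noteq> 0" "CL = focal_conic F e"
      using CL unfolding conic_with_focus_def by blast
    \<comment> \<open>The sides 0, n, 1 and n + 1 are two pairs of opposite sides, enough to
      identify the tangent conic's form up to a scalar.\<close>
    have "tangent_line {x. chord_form F d c w \<bullet> x = 0} (focal_conic F e)"
      if "w \<in> {m 0, - m 0, cis \<theta> * m 0, - (cis \<theta> * m 0)}" for w
    proof -
      have "- m 0 = m n" "cis \<theta> * m 0 = m 1" "- (cis \<theta> * m 0) = m (Suc n)"
        using mn[of 0] mn[of 1] mSuc[of 0] by auto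
      then have "w \<in> m ` {0, n, 1, Suc n}" using that by auto
      moreover have "{0, n, 1, Suc n} \<subseteq> {..<2 * n}" using assms(1) by auto
      ultimately obtain i where "i < 2 * n" "w = m i" by blast
      then show ?thesis using tangent[of i] by (simp add: side e del: inner_chord_form)
    qed
    then obtain k where k: "k \<noteq> 0" "e = k *\<^sub>R d"
      using opposite_tangents_same_directrix[OF p0 e(1) m sin] by blast
    obtain j where "from_focus F F' = j *\<^sub>R fst e"
      using other_focus_on_axis[OF e(1)] CL(2) F' e(2) by blast
    then have "from_focus F F' = (j * k) *\<^sub>R fst d" by (simp add: k)
    then show ?thesis unfolding l_def by (rule orthogonal_lines_directrix[OF p0 F'])
  qed
  have "discrete_conic n P l F"
  proof -
    have "degenerate_conic_with_focus l F"
      using l p0 by (simp add: degenerate_conic_with_focus_def l_def)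
    \<comment> \<open>Coincidence would mean that \<open>m i\<close> is \<open>m j\<close> or
      \<open>- m j = m (j + n)\<close>; both indices lie below \<open>2 * n\<close>, where the
      powers of \<open>cis \<theta>\<close> are distinct.\<close>
    moreover have "P i \<notin> span {P j}" if ij: "i < n" "j < n" "i \<noteq> j" for i j
    proof
      assume "P i \<in> span {P j}"
      then have "\<i> * m i = \<i> * m j \<or> \<i> * m i = - (\<i> * m j)"
        unfolding P_def using directrix_point_in_spanD[OF p0 im im] by blast
      then have "\<i> * m i = \<i> * m j \<or> \<i> * m i = \<i> * m (j + n)" by (simp add: mn)
      then have "m i = m j \<or> m i = m (j + n)" unfolding mult_cancel_left by simp
      then have "cis \<theta> ^ i = cis \<theta> ^ j \<or> cis \<theta> ^ i = cis \<theta> ^ (j + n)"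
        using u by (auto simp: m_def)
      then show False using inj[of i j] inj[of i "j + n"] ij by auto
    qed
    moreover have "has_angle l F (P i) (P (Suc i mod n)) \<theta>" if i: "i < n" for i
      unfolding has_angle_def
    proof (intro exI conjI)
      show "norm (\<i> * m i) = 1" by (rule im)
      show "ray_reaches l F (\<i> * m i) (P i)"
        unfolding l_def P_def by (rule ray_reaches_directrix_point[OF p]) (simp add: span_base)
      \<comment> \<open>When the polygon of the \<open>P i\<close> closes up, the direction has only
        turned to its opposite, since \<open>m n = - m 0\<close>. On a line both opposite rays reach
        the same point, so the angle \<theta> still fits.\<close>
      have "P (Suc i mod n) \<in> span {directrix_point F d (\<i> * m (Suc i))}"
      proof (cases "Suc i = n")
        case True
        have "directrix_point F d (- (\<i> * m 0)) = - directrix_point F d (\<i> * m 0)"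
          by (simp add: directrix_point_def)
        moreover have "m n = - m 0" using mn[of 0] by simp
        ultimately have "directrix_point F d (\<i> * m (Suc i)) = - P 0" by (simp add: True P_def)
        then show ?thesis using True span_neg[OF span_base[of "- P 0" "{- P 0}"]] by simp
      next
        case False
        then show ?thesis using i by (simp add: P_def span_base)
      qed
      then have "ray_reaches l F (\<i> * m (Suc i)) (P (Suc i mod n))"
        unfolding l_def by (rule ray_reaches_directrix_point[OF p])
      then show "ray_reaches l F (cis \<theta> * (\<i> * m i)) (P (Suc i mod n))"
        by (simp add: mSuc mult.left_commute)
    qed
    ultimately show ?thesis
      unfolding discrete_conic_def polygon_def using assms(1) P0 Pl by blast
  qed
  moreover have "l = l'" if "parabola_with C F l'" for l'
  proof -
    obtain e where e: "e \<bullet> (F, 1) \<noteq> 0" "focal_conic F d = focal_conic F e" "l' = {x. e \<bullet> x = 0}"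
      using \<open>parabola_with C F l'\<close> unfolding parabola_with_def C by blast
    obtain k where "k \<noteq> 0" "e = k *\<^sub>R d" using focal_conic_inject[OF p0 e(1,2)] by blast
    then show ?thesis by (simp add: l_def e(3))
  qed
  ultimately show ?thesis using l P0 Pl Int orth by blast
qed

end
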